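(* For every integer $n>1$, the $\mathbb{Z}$-algebra $\mathbb{Z}[x_1,\dots,x_n]$ is not quasi-free.
   Context: Let $k$ be a commutative ring and $A$ a $k$-algebra (associative, unital, not necessarily commutative). A $k$-Hochschild extension of $A$ by an $(A,A)$-bimodule $M$ is a short exact sequence $0\to M\to B\xrightarrow{\pi}A\to 0$ in which $B$ is a $k$-algebra (not necessarily commutative), $\pi$ is a $k$-algebra homomorphism that splits as a map of $k$-modules, and $M$ is identified with the square-zero ideal $\ker\pi$ compatibly with the bimodule structure. It lifts if $\pi$ has a section that is a $k$-algebra homomorphism. $A$ is a quasi-free $k$-algebra if every $k$-Hochschild extension of $A$ by every $(A,A)$-bimodule lifts. Here $k=\mathbb{Z}$. *)

theory Defs
  imports "HOL-Library.Poly_Mapping" "HOL-Algebra.Algebra"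
begin

(* HOL-Algebra's locale algebra forces commutativity, hence a separate locale. *)

locale assoc_algebra = module R M + ring M for R (structure) and M (structure) +
  assumes smult_mult_left:
      "\<lbrakk>c \<in> carrier R; x \<in> carrier M; y \<in> carrier M\<rbrakk> \<Longrightarrow>
        (c \<odot>\<^bsub>M\<^esub> x) \<otimes>\<^bsub>M\<^esub> y = c \<odot>\<^bsub>M\<^esub> (x \<otimes>\<^bsub>M\<^esub> y)"
    and smult_mult_right:
      "\<lbrakk>c \<in> carrier R; x \<in> carrier M; y \<in> carrier M\<rbrakk> \<Longrightarrow>
        x \<otimes>\<^bsub>M\<^esub> (c \<odot>\<^bsub>M\<^esub> y) = c \<odot>\<^bsub>M\<^esub> (x \<otimes>\<^bsub>M\<^esub> y)"

definition module_hom ::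
    "('c, 'r) ring_scheme \<Rightarrow> ('c, 'a, 'x) module_scheme \<Rightarrow> ('c, 'b, 'y) module_scheme \<Rightarrow> ('a \<Rightarrow> 'b) set"
  where "module_hom k M N =
    {f. f \<in> carrier M \<rightarrow> carrier N \<and>
        (\<forall>x\<in>carrier M. \<forall>y\<in>carrier M. f (x \<oplus>\<^bsub>M\<^esub> y) = f x \<oplus>\<^bsub>N\<^esub> f y) \<and>
        (\<forall>c\<in>carrier k. \<forall>x\<in>carrier M. f (c \<odot>\<^bsub>M\<^esub> x) = c \<odot>\<^bsub>N\<^esub> f x)}"

definition algebra_hom ::
    "('c, 'r) ring_scheme \<Rightarrow> ('c, 'a, 'x) module_scheme \<Rightarrow> ('c, 'b, 'y) module_scheme \<Rightarrow> ('a \<Rightarrow> 'b) set"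
  where "algebra_hom k A B = ring_hom A B \<inter> module_hom k A B"

(* As for modules in HOL-Algebra, the inherited fields mult and one carry no meaning here. *)

record ('c, 'a, 'm) bimodule = "('c, 'm) module" +
  lact :: "'a \<Rightarrow> 'm \<Rightarrow> 'm"
  ract :: "'m \<Rightarrow> 'a \<Rightarrow> 'm"

(* (A,A)-bimodules over a k-algebra A; the last two axioms say that k acts the same way
   through A on the left, through A on the right, and directly.  For k the ring of integers
   they follow from the other axioms. *)

locale bimodule = A: assoc_algebra k A + M: module k M
  for k :: "('c, 'r) ring_scheme" (structure)
    and A :: "('c, 'a, 'x) module_scheme" (structure)
    and M :: "('c, 'a, 'm, 'y) bimodule_scheme" (structure) +
  assumes lact_closed:
      "\<lbrakk>a \<in> carrier A; m \<in> carrier M\<rbrakk> \<Longrightarrow> lact M a m \<in> carrier M"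
    and ract_closed:
      "\<lbrakk>a \<in> carrier A; m \<in> carrier M\<rbrakk> \<Longrightarrow> ract M m a \<in> carrier M"
    and lact_add:
      "\<lbrakk>a \<in> carrier A; m \<in> carrier M; m' \<in> carrier M\<rbrakk> \<Longrightarrow>
        lact M a (m \<oplus>\<^bsub>M\<^esub> m') = lact M a m \<oplus>\<^bsub>M\<^esub> lact M a m'"
    and add_lact:
      "\<lbrakk>a \<in> carrier A; b \<in> carrier A; m \<in> carrier M\<rbrakk> \<Longrightarrow>
        lact M (a \<oplus>\<^bsub>A\<^esub> b) m = lact M a m \<oplus>\<^bsub>M\<^esub> lact M b m"
    and lact_mult:
      "\<lbrakk>a \<in> carrier A; b \<in> carrier A; m \<in> carrier M\<rbrakk> \<Longrightarrow>
        lact M (a \<otimes>\<^bsub>A\<^esub> b) m = lact M a (lact M b m)"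
    and lact_one:
      "m \<in> carrier M \<Longrightarrow> lact M \<one>\<^bsub>A\<^esub> m = m"
    and ract_add:
      "\<lbrakk>a \<in> carrier A; m \<in> carrier M; m' \<in> carrier M\<rbrakk> \<Longrightarrow>
        ract M (m \<oplus>\<^bsub>M\<^esub> m') a = ract M m a \<oplus>\<^bsub>M\<^esub> ract M m' a"
    and add_ract:
      "\<lbrakk>a \<in> carrier A; b \<in> carrier A; m \<in> carrier M\<rbrakk> \<Longrightarrow>
        ract M m (a \<oplus>\<^bsub>A\<^esub> b) = ract M m a \<oplus>\<^bsub>M\<^esub> ract M m b"
    and ract_mult:
      "\<lbrakk>a \<in> carrier A; b \<in> carrier A; m \<in> carrier M\<rbrakk> \<Longrightarrow>
        ract M m (a \<otimes>\<^bsub>A\<^esub> b) = ract M (ract M m a) b"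
    and ract_one:
      "m \<in> carrier M \<Longrightarrow> ract M m \<one>\<^bsub>A\<^esub> = m"
    and lact_ract:
      "\<lbrakk>a \<in> carrier A; b \<in> carrier A; m \<in> carrier M\<rbrakk> \<Longrightarrow>
        ract M (lact M a m) b = lact M a (ract M m b)"
    and lact_scalar:
      "\<lbrakk>c \<in> carrier k; m \<in> carrier M\<rbrakk> \<Longrightarrow> lact M (c \<odot>\<^bsub>A\<^esub> \<one>\<^bsub>A\<^esub>) m = c \<odot>\<^bsub>M\<^esub> m"
    and ract_scalar:
      "\<lbrakk>c \<in> carrier k; m \<in> carrier M\<rbrakk> \<Longrightarrow> ract M m (c \<odot>\<^bsub>A\<^esub> \<one>\<^bsub>A\<^esub>) = c \<odot>\<^bsub>M\<^esub> m"

(* The short exact sequence 0 -> M -i-> B -p-> A -> 0.  The bimodule structure that the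
   square-zero ideal ker p inherits from B is  p b . x = b x  and  x . p b = x b;
   i_lact and i_ract express that i identifies M with ker p as bimodules. *)

locale hochschild_extension = bimodule k A M + B: assoc_algebra k B
  for k (structure) and A (structure) and M (structure) and B (structure)
    and i and p +
  assumes i_hom: "i \<in> module_hom k M B"
    and i_inj: "inj_on i (carrier M)"
    and p_hom: "p \<in> algebra_hom k B A"
    and p_surj: "p ` carrier B = carrier A"
    and exact: "i ` carrier M = a_kernel B A p"
    and p_split: "\<exists>s\<in>module_hom k A B. \<forall>a\<in>carrier A. p (s a) = a"
    and square_zero: "\<lbrakk>x \<in> a_kernel B A p; y \<in> a_kernel B A p\<rbrakk> \<Longrightarrow> x \<otimes>\<^bsub>B\<^esub> y = \<zero>\<^bsub>B\<^esub>"
    and i_lact: "\<lbrakk>b \<in> carrier B; m \<in> carrier M\<rbrakk> \<Longrightarrow> i (lact M (p b) m) = b \<otimes>\<^bsub>B\<^esub> i m"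
    and i_ract: "\<lbrakk>b \<in> carrier B; m \<in> carrier M\<rbrakk> \<Longrightarrow> i (ract M m (p b)) = i m \<otimes>\<^bsub>B\<^esub> b"

definition extension_lifts ::
    "('c, 'r) ring_scheme \<Rightarrow> ('c, 'a, 'x) module_scheme \<Rightarrow> ('c, 'b, 'y) module_scheme \<Rightarrow> ('b \<Rightarrow> 'a) \<Rightarrow> bool"
  where "extension_lifts k A B p \<longleftrightarrow>
    (\<exists>s\<in>algebra_hom k A B. \<forall>a\<in>carrier A. p (s a) = a)"

(* HOL cannot quantify over types inside a formula, so quasi-freeness is relative to a type 'u
   that plays the role of a universe: M and B range over all bimodules and algebras whose
   carriers are subsets of 'u.  Too small a 'u (e.g. a finite one, for infinite A) makes the
   property hold vacuously. *)

definition quasi_free ::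
    "'u itself \<Rightarrow> ('c, 'r) ring_scheme \<Rightarrow> ('c, 'a, 'x) module_scheme \<Rightarrow> bool"
  where "quasi_free U k A \<longleftrightarrow>
    (\<forall>(M :: ('c, 'a, 'u) bimodule) (B :: ('c, 'u) module) i p.
       hochschild_extension k A M B i p \<longrightarrow> extension_lifts k A B p)"

(* Z[x_1, ..., x_n].  A monomial is its finitely supported exponent function nat =>0 nat,
   a polynomial is a finitely supported function from monomials to integers, and the
   multiplication of poly_mapping is convolution.  The carrier consists of the polynomials
   in whose monomials only the indices 1, ..., n occur. *)

definition int_poly_algebra :: "nat \<Rightarrow> (int, (nat \<Rightarrow>\<^sub>0 nat) \<Rightarrow>\<^sub>0 int) module"
  where "int_poly_algebra n =
    \<lparr>carrier = {f. \<forall>m\<in>Poly_Mapping.keys f. Poly_Mapping.keys m \<subseteq> {1..n}},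
     monoid.mult = (*), one = 1, ring.zero = 0, add = (+), smult = (\<lambda>c f. of_int c * f)\<rparr>"

lemma int_poly_algebra_closed:
  fixes f g :: "(nat \<Rightarrow>\<^sub>0 nat) \<Rightarrow>\<^sub>0 int"
  assumes "f \<in> carrier (int_poly_algebra n)" "g \<in> carrier (int_poly_algebra n)"
  shows "f + g \<in> carrier (int_poly_algebra n)" "f * g \<in> carrier (int_poly_algebra n)"
    "- f \<in> carrier (int_poly_algebra n)" "of_int c * f \<in> carrier (int_poly_algebra n)"
proof -
  have f: "\<And>m. m \<in> Poly_Mapping.keys f \<Longrightarrow> Poly_Mapping.keys m \<subseteq> {1..n}"
    and g: "\<And>m. m \<in> Poly_Mapping.keys g \<Longrightarrow> Poly_Mapping.keys m \<subseteq> {1..n}"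
    using assms by (auto simp: int_poly_algebra_def)
  show "f + g \<in> carrier (int_poly_algebra n)"
    using f g Poly_Mapping.keys_add[of f g] by (fastforce simp: int_poly_algebra_def)
  have mult: "h * h' \<in> carrier (int_poly_algebra n)"
    if h: "\<And>m. m \<in> Poly_Mapping.keys h \<Longrightarrow> Poly_Mapping.keys m \<subseteq> {1..n}"
      "\<And>m. m \<in> Poly_Mapping.keys h' \<Longrightarrow> Poly_Mapping.keys m \<subseteq> {1..n}"
    for h h' :: "(nat \<Rightarrow>\<^sub>0 nat) \<Rightarrow>\<^sub>0 int"
  proof -
    have "Poly_Mapping.keys m \<subseteq> {1..n}" if m: "m \<in> Poly_Mapping.keys (h * h')" for m
    proof -
      obtain a b where "m = a + b" "a \<in> Poly_Mapping.keys h" "b \<in> Poly_Mapping.keys h'"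
        using subsetD[OF Poly_Mapping.keys_mult m] by blast
      then show ?thesis
        using Poly_Mapping.keys_add[of a b] h(1)[of a] h(2)[of b] by blast
    qed
    then show ?thesis by (simp add: int_poly_algebra_def)
  qed
  show "f * g \<in> carrier (int_poly_algebra n)" using mult f g by blast
  show "- f \<in> carrier (int_poly_algebra n)" using f by (simp add: int_poly_algebra_def)
  have "(of_int c :: (nat \<Rightarrow>\<^sub>0 nat) \<Rightarrow>\<^sub>0 int) = Poly_Mapping.single 0 c"
    by (metis of_int_eq_id id_apply single_of_int)
  then have c: "Poly_Mapping.keys m \<subseteq> {1..n}"
    if "m \<in> Poly_Mapping.keys (of_int c :: (nat \<Rightarrow>\<^sub>0 nat) \<Rightarrow>\<^sub>0 int)" for m
    using that by (simp split: if_splits)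
  show "of_int c * f \<in> carrier (int_poly_algebra n)" using mult[OF c f] .
qed

lemma int_poly_algebra_simps:
  "\<zero>\<^bsub>int_poly_algebra n\<^esub> = 0" "\<one>\<^bsub>int_poly_algebra n\<^esub> = 1"
  "f \<oplus>\<^bsub>int_poly_algebra n\<^esub> g = f + g" "f \<otimes>\<^bsub>int_poly_algebra n\<^esub> g = f * g"
  "c \<odot>\<^bsub>int_poly_algebra n\<^esub> f = of_int c * f"
  "0 \<in> carrier (int_poly_algebra n)" "1 \<in> carrier (int_poly_algebra n)"
  by (simp_all add: int_poly_algebra_def)

lemma int_poly_algebra_cring: "cring (int_poly_algebra n)"
proof (rule cringI)
  show "abelian_group (int_poly_algebra n)"
  proof (rule abelian_groupI)
    fix x assume "x \<in> carrier (int_poly_algebra n)"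
    then show "\<exists>y\<in>carrier (int_poly_algebra n).
        y \<oplus>\<^bsub>int_poly_algebra n\<^esub> x = \<zero>\<^bsub>int_poly_algebra n\<^esub>"
      using int_poly_algebra_closed(3)[of x n x]
      by (intro bexI[of _ "- x"]) (simp_all add: int_poly_algebra_simps)
  qed (simp_all add: int_poly_algebra_simps int_poly_algebra_closed(1) add.assoc add.commute)
  show "Group.comm_monoid (int_poly_algebra n)"
    by (rule comm_monoidI)
      (simp_all add: int_poly_algebra_simps int_poly_algebra_closed(2) mult.assoc mult.commute)
qed (simp add: int_poly_algebra_simps distrib_right)

lemma int_poly_algebra_is_algebra: "assoc_algebra \<Z> (int_poly_algebra n)"
proof -
  interpret cring "int_poly_algebra n" by (rule int_poly_algebra_cring)
  have "module \<Z> (int_poly_algebra n)"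
    by (rule moduleI[OF int_is_cring is_abelian_group])
      (simp_all add: int_poly_algebra_simps int_poly_algebra_closed(4)
        distrib_left distrib_right mult.assoc)
  then show ?thesis
    by (intro assoc_algebra.intro assoc_algebra_axioms.intro ring_axioms)
      (simp_all add: int_poly_algebra_simps mult.assoc mult.left_commute)
qed

end

theory Submission
  imports Defs "HOL-Library.Countable"
begin

text \<open>Let \<open>\<int>\<close> be the symmetric bimodule on which every variable acts as zero.  The Hochschild
  2-cocycle \<open>(f, g) \<mapsto> \<partial>f/\<partial>x\<^sub>1(0) \<cdot> \<partial>g/\<partial>x\<^sub>2(0)\<close> defines a square-zero extension of the
  polynomial ring by \<open>\<int>\<close> in which any two lifts of \<open>x\<^sub>1\<close> and \<open>x\<^sub>2\<close> have commutator 1 in \<open>\<int>\<close>.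
  An algebra section would provide commuting lifts.\<close>

section \<open>Countability of polynomial rings, to embed the extension into any infinite
  type\<close>

instance poly_mapping :: (countable, "{countable, zero}") countable
proof (rule countable_classI)
  \<comment> \<open>A finitely supported function is coded by a list of its key-value pairs: its
    graph over the support is finite, and lists over a countable type are countable.\<close>
  define graph where "graph f = (\<lambda>k. (k, Poly_Mapping.lookup f k)) ` Poly_Mapping.keys f" for f :: "'a \<Rightarrow>\<^sub>0 'b"
  define enum where "enum f = (SOME xs. set xs = graph f)" for f :: "'a \<Rightarrow>\<^sub>0 'b"
  have enum: "set (enum f) = graph f" for f
    unfolding enum_def by (rule someI_ex) (simp add: graph_def finite_list)
  have lookup_graph: "v = Poly_Mapping.lookup f k" if "(k, v) \<in> graph f" for f k v
    using that by (auto simp: graph_def)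
  have in_graph: "Poly_Mapping.lookup f k \<noteq> 0 \<longleftrightarrow> (\<exists>v. (k, v) \<in> graph f)" for f k
    by (auto simp: graph_def lookup_not_eq_zero_eq_in_keys image_iff)
  fix f g :: "'a \<Rightarrow>\<^sub>0 'b"
  assume "to_nat (enum f) = to_nat (enum g)"
  then have "graph f = graph g"
    using enum by (metis from_nat_to_nat)
  \<comment> \<open>A key absent from the common graph has value 0 under both functions.\<close>
  then have "Poly_Mapping.lookup f k = Poly_Mapping.lookup g k" for k
    using in_graph[of f k] in_graph[of g k] lookup_graph[of k _ f] lookup_graph[of k _ g]
    by metis
  then show "f = g"
    by (rule poly_mapping_eqI)
qed

section \<open>Products of polynomials in degrees 0 and 1\<close>

lemma lookup_mult_finite:
  fixes f g :: "'a::monoid_add \<Rightarrow>\<^sub>0 'b::semiring_0"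
  assumes "finite {(a, b). a + b = k}"
  shows "Poly_Mapping.lookup (f * g) k = (\<Sum>(a, b) \<in> {(a, b). a + b = k}.
      Poly_Mapping.lookup f a * Poly_Mapping.lookup g b)"
proof -
  have "Poly_Mapping.lookup (f * g) k =
      (\<Sum>(a, b). Poly_Mapping.lookup f a * Poly_Mapping.lookup g b when k = a + b)"
    by (simp add: times_poly_mapping.rep_eq prod_fun_unfold_prod)
  also have "\<dots> = (\<Sum>(a, b) \<in> {(a, b). a + b = k}.
      Poly_Mapping.lookup f a * Poly_Mapping.lookup g b when k = a + b)"
    by (rule Sum_any.expand_superset[OF assms]) auto
  also have "\<dots> = (\<Sum>(a, b) \<in> {(a, b). a + b = k}.
      Poly_Mapping.lookup f a * Poly_Mapping.lookup g b)"
    by (rule sum.cong) auto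
  finally show ?thesis .
qed

lemma add_eq_0_poly_mapping:
  fixes a b :: "'a \<Rightarrow>\<^sub>0 nat"
  shows "a + b = 0 \<longleftrightarrow> a = 0 \<and> b = 0"
  by (metis add.right_neutral add_is_0 lookup_add lookup_zero poly_mapping_eqI)

text \<open>Exponents are natural numbers, so the monomial \<open>x_i\<close> factors only
  trivially. Hence its coefficient in a product has just two terms, which give the product
  rule.\<close>

lemma add_eq_single_1_iff:
  fixes a b :: "'a \<Rightarrow>\<^sub>0 nat"
  shows "a + b = Poly_Mapping.single i 1 \<longleftrightarrow>
    a = 0 \<and> b = Poly_Mapping.single i 1 \<or> a = Poly_Mapping.single i 1 \<and> b = 0"
    (is "?l \<longleftrightarrow> ?r")
proof
  assume ?l
  then have s: "Poly_Mapping.lookup a k + Poly_Mapping.lookup b k = (1 when i = k)" for k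
    by (metis lookup_add lookup_single)
  have off: "Poly_Mapping.lookup a k = 0 \<and> Poly_Mapping.lookup b k = 0" if "k \<noteq> i" for k
    using s[of k] that by simp
  have "Poly_Mapping.lookup a i = 0 \<and> Poly_Mapping.lookup b i = 1 \<or>
      Poly_Mapping.lookup a i = 1 \<and> Poly_Mapping.lookup b i = 0"
    using s[of i] by auto
  then show ?r
  proof (elim disjE conjE)
    assume h: "Poly_Mapping.lookup a i = 0" "Poly_Mapping.lookup b i = 1"
    have "a = 0" "b = Poly_Mapping.single i 1"
      by (rule poly_mapping_eqI, metis h off lookup_zero,
          rule poly_mapping_eqI, metis h off lookup_single_eq lookup_single_not_eq)
    then show ?r by simp
  next
    assume h: "Poly_Mapping.lookup a i = 1" "Poly_Mapping.lookup b i = 0"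
    have "b = 0" "a = Poly_Mapping.single i 1"
      by (rule poly_mapping_eqI, metis h off lookup_zero,
          rule poly_mapping_eqI, metis h off lookup_single_eq lookup_single_not_eq)
    then show ?r by simp
  qed
qed auto

type_synonym int_poly = "(nat \<Rightarrow>\<^sub>0 nat) \<Rightarrow>\<^sub>0 int"

definition var :: "nat \<Rightarrow> int_poly"
  where "var i = Poly_Mapping.single (Poly_Mapping.single i 1) 1"

text \<open>The augmentation \<open>f(0)\<close>, through which polynomials will act on the kernel
  from both sides.\<close>

definition coeff0 :: "int_poly \<Rightarrow> int"
  where "coeff0 f = Poly_Mapping.lookup f 0"

text \<open>The partial derivative in the variable \<open>x_i\<close> at the origin.\<close>

definition coeff1 :: "nat \<Rightarrow> int_poly \<Rightarrow> int"
  where "coeff1 i f = Poly_Mapping.lookup f (Poly_Mapping.single i 1)"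

lemma single_1_neq_0: "Poly_Mapping.single i (1::nat) \<noteq> 0"
  by (metis lookup_single_eq lookup_zero zero_neq_one)

lemma coeff0_simps [simp]:
  "coeff0 0 = 0" "coeff0 1 = 1" "coeff0 (f + g) = coeff0 f + coeff0 g"
  "coeff0 (- f) = - coeff0 f" "coeff0 (of_int c) = c" "coeff0 (var i) = 0"
  "coeff0 (f * g) = coeff0 f * coeff0 g"
proof -
  have "{(a, b). a + b = 0} = {(0, 0 :: nat \<Rightarrow>\<^sub>0 nat)}"
    by (auto simp: add_eq_0_poly_mapping)
  then show "coeff0 (f * g) = coeff0 f * coeff0 g"
    by (simp add: coeff0_def lookup_mult_finite)
qed (simp_all add: coeff0_def lookup_add lookup_of_int var_def lookup_single single_1_neq_0
      del: One_nat_def)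

text \<open>The last rule makes \<open>coeff1 i\<close> a derivation into the integers, acted on
  through \<open>coeff0\<close>; the cocycle identity rests on it.\<close>

lemma coeff1_simps [simp]:
  "coeff1 i 0 = 0" "coeff1 i 1 = 0" "coeff1 i (f + g) = coeff1 i f + coeff1 i g"
  "coeff1 i (- f) = - coeff1 i f" "coeff1 i (of_int c) = 0"
  "coeff1 i (f * g) = coeff0 f * coeff1 i g + coeff1 i f * coeff0 g"
proof -
  have P: "{(a, b). a + b = Poly_Mapping.single i (1::nat)} =
      {(0, Poly_Mapping.single i 1), (Poly_Mapping.single i 1, 0)}"
    using add_eq_single_1_iff[of _ _ i] by auto
  have "finite {(a, b). a + b = Poly_Mapping.single i (1::nat)}"
    unfolding P by simp
  from lookup_mult_finite[OF this, of f g]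
  show "coeff1 i (f * g) = coeff0 f * coeff1 i g + coeff1 i f * coeff0 g"
    unfolding P using single_1_neq_0[of i] by (simp add: coeff0_def coeff1_def del: One_nat_def)
qed (simp_all add: coeff1_def lookup_add lookup_one lookup_of_int single_1_neq_0
      del: One_nat_def)

lemma coeff1_var: "coeff1 i (var j) = (if i = j then 1 else 0)"
proof -
  have "Poly_Mapping.single i (1::nat) \<noteq> Poly_Mapping.single j 1" if "i \<noteq> j"
    using that by (metis lookup_single_eq lookup_single_not_eq zero_neq_one)
  then show ?thesis
    by (auto simp: coeff1_def var_def lookup_single when_def simp del: One_nat_def)
qed

lemma var_closed: "\<lbrakk>1 \<le> i; i \<le> n\<rbrakk> \<Longrightarrow> var i \<in> carrier (int_poly_algebra n)"
  by (auto simp: int_poly_algebra_def var_def)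

section \<open>The square-zero extension, with the cocycle as last summand of its product\<close>

fun ext_mult :: "int_poly \<times> int \<Rightarrow> int_poly \<times> int \<Rightarrow> int_poly \<times> int"
  where "ext_mult (f, x) (g, y) = (f * g, coeff0 f * y + x * coeff0 g + coeff1 1 f * coeff1 2 g)"

fun ext_add :: "int_poly \<times> int \<Rightarrow> int_poly \<times> int \<Rightarrow> int_poly \<times> int"
  where "ext_add (f, x) (g, y) = (f + g, x + y)"

fun ext_smult :: "int \<Rightarrow> int_poly \<times> int \<Rightarrow> int_poly \<times> int"
  where "ext_smult c (f, x) = (of_int c * f, c * x)"

text \<open>The injection \<open>h\<close> moves the extension into an arbitrary infinite type.\<close>

locale noncommutative_extension =
  fixes h :: "int_poly \<times> int \<Rightarrow> 'u" and n :: nat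
  assumes inj_h: "inj h" and n_gt_1: "n > 1"
begin

abbreviation decode :: "'u \<Rightarrow> int_poly \<times> int"
  where "decode \<equiv> inv_into UNIV h"

definition ext_algebra :: "(int, 'u) module"
  where "ext_algebra =
    \<lparr>carrier = h ` (carrier (int_poly_algebra n) \<times> UNIV),
     monoid.mult = (\<lambda>u v. h (ext_mult (decode u) (decode v))), one = h (1, 0),
     ring.zero = h (0, 0), add = (\<lambda>u v. h (ext_add (decode u) (decode v))),
     smult = (\<lambda>c u. h (ext_smult c (decode u)))\<rparr>"

text \<open>It shares the type and the encoding of \<open>ext_algebra\<close>, so that the inclusion
  is the identity map.\<close>

definition ext_kernel :: "(int, int_poly, 'u) bimodule"
  where "ext_kernel =
    \<lparr>carrier = h ` ({0} \<times> UNIV),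
     monoid.mult = undefined, one = undefined,
     ring.zero = h (0, 0), add = (\<lambda>u v. h (ext_add (decode u) (decode v))),
     smult = (\<lambda>c u. h (ext_smult c (decode u))),
     lact = (\<lambda>f u. h (0, coeff0 f * snd (decode u))),
     ract = (\<lambda>u f. h (0, coeff0 f * snd (decode u)))\<rparr>"

definition ext_proj :: "'u \<Rightarrow> int_poly"
  where "ext_proj u = fst (decode u)"

lemma decode_h [simp]: "decode (h u) = u"
  by (simp add: inj_h)

lemma h_eq [simp]: "h u = h v \<longleftrightarrow> u = v"
  by (simp add: inj_eq inj_h)

lemma ext_proj_h [simp]: "ext_proj (h (f, x)) = f"
  by (simp add: ext_proj_def)

lemma ext_algebra_simps [simp]:
  "h (f, x) \<in> carrier ext_algebra \<longleftrightarrow> f \<in> carrier (int_poly_algebra n)"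
  "\<zero>\<^bsub>ext_algebra\<^esub> = h (0, 0)" "\<one>\<^bsub>ext_algebra\<^esub> = h (1, 0)"
  "h u \<oplus>\<^bsub>ext_algebra\<^esub> h v = h (ext_add u v)"
  "h u \<otimes>\<^bsub>ext_algebra\<^esub> h v = h (ext_mult u v)"
  "c \<odot>\<^bsub>ext_algebra\<^esub> h u = h (ext_smult c u)"
  by (auto simp: ext_algebra_def)

lemma ext_algebra_cases:
  assumes "u \<in> carrier ext_algebra"
  obtains f x where "u = h (f, x)" "f \<in> carrier (int_poly_algebra n)"
  using assms by (auto simp: ext_algebra_def)

lemma ext_kernel_simps [simp]:
  "h (f, x) \<in> carrier ext_kernel \<longleftrightarrow> f = 0"
  "\<zero>\<^bsub>ext_kernel\<^esub> = h (0, 0)"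
  "h u \<oplus>\<^bsub>ext_kernel\<^esub> h v = h (ext_add u v)"
  "c \<odot>\<^bsub>ext_kernel\<^esub> h u = h (ext_smult c u)"
  "lact ext_kernel f (h (g, x)) = h (0, coeff0 f * x)"
  "ract ext_kernel (h (g, x)) f = h (0, coeff0 f * x)"
  by (auto simp: ext_kernel_def)

lemma ext_kernel_cases:
  assumes "u \<in> carrier ext_kernel"
  obtains x where "u = h (0, x)"
  using assms by (auto simp: ext_kernel_def)

lemmas poly_simps = int_poly_algebra_simps int_poly_algebra_closed

section \<open>The axioms of a Hochschild extension\<close>

lemma ext_algebra_abelian_group: "abelian_group ext_algebra"
proof (rule abelian_groupI)
  fix u assume "u \<in> carrier ext_algebra"
  then obtain f x where "u = h (f, x)" "f \<in> carrier (int_poly_algebra n)"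
    by (rule ext_algebra_cases)
  then show "\<exists>v\<in>carrier ext_algebra. v \<oplus>\<^bsub>ext_algebra\<^esub> u = \<zero>\<^bsub>ext_algebra\<^esub>"
    by (intro bexI[of _ "h (- f, - x)"]) (simp_all add: poly_simps)
qed (auto simp: poly_simps elim!: ext_algebra_cases)

lemma ext_algebra_is_algebra: "assoc_algebra \<Z> ext_algebra"
proof -
  \<comment> \<open>Associativity is the cocycle identity. The cocycle is the cup product of the
    derivations \<open>coeff1 1\<close> and \<open>coeff1 2\<close>, so the product rule gives the
    same correction for both bracketings. The unit needs no correction because \<open>coeff1\<close>
    kills constants.\<close>
  have "monoid ext_algebra"
    by (rule monoidI) (auto simp: poly_simps algebra_simps elim!: ext_algebra_cases)
  then have "ring ext_algebra"
    by (intro ringI ext_algebra_abelian_group)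
      (auto simp: poly_simps algebra_simps elim!: ext_algebra_cases)
  moreover have "module \<Z> ext_algebra"
    by (rule moduleI[OF int_is_cring ext_algebra_abelian_group])
      (auto simp: poly_simps distrib_left distrib_right mult.assoc elim!: ext_algebra_cases)
  ultimately show ?thesis
    by (intro assoc_algebra.intro assoc_algebra_axioms.intro)
      (auto simp: algebra_simps elim!: ext_algebra_cases)
qed

lemma ext_kernel_module: "module \<Z> ext_kernel"
proof (rule moduleI[OF int_is_cring])
  show "abelian_group ext_kernel"
  proof (rule abelian_groupI)
    fix u assume "u \<in> carrier ext_kernel"
    then obtain x where "u = h (0, x)"
      by (rule ext_kernel_cases)
    then show "\<exists>v\<in>carrier ext_kernel. v \<oplus>\<^bsub>ext_kernel\<^esub> u = \<zero>\<^bsub>ext_kernel\<^esub>"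
      by (intro bexI[of _ "h (0, - x)"]) simp_all
  qed (auto elim!: ext_kernel_cases)
qed (auto simp: algebra_simps elim!: ext_kernel_cases)

lemma ext_kernel_bimodule: "bimodule \<Z> (int_poly_algebra n) ext_kernel"
  by (intro bimodule.intro bimodule_axioms.intro int_poly_algebra_is_algebra ext_kernel_module)
    (auto simp: int_poly_algebra_simps algebra_simps elim!: ext_kernel_cases)

lemma ext_kernel_eq: "carrier ext_kernel = a_kernel ext_algebra (int_poly_algebra n) ext_proj"
  by (auto simp: a_kernel_def' int_poly_algebra_simps elim!: ext_kernel_cases ext_algebra_cases)

lemma ext_proj_hom: "ext_proj \<in> algebra_hom \<Z> ext_algebra (int_poly_algebra n)"
  by (auto simp: algebra_hom_def module_hom_def ring_hom_def int_poly_algebra_simps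
      elim!: ext_algebra_cases)

lemma ext_hochschild:
  "hochschild_extension \<Z> (int_poly_algebra n) ext_kernel ext_algebra (\<lambda>u. u) ext_proj"
proof (intro hochschild_extension.intro hochschild_extension_axioms.intro
    ext_kernel_bimodule ext_algebra_is_algebra ext_proj_hom)
  show "(\<lambda>u. u) \<in> module_hom \<Z> ext_kernel ext_algebra"
    by (auto simp: module_hom_def int_poly_algebra_simps elim!: ext_kernel_cases)
  show "ext_proj ` carrier ext_algebra = carrier (int_poly_algebra n)"
  proof
    show "carrier (int_poly_algebra n) \<subseteq> ext_proj ` carrier ext_algebra"
    proof
      fix f assume "f \<in> carrier (int_poly_algebra n)"
      then show "f \<in> ext_proj ` carrier ext_algebra"
        by (intro image_eqI[of _ _ "h (f, 0)"]) simp_all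
    qed
  qed (auto elim!: ext_algebra_cases)
  \<comment> \<open>The cocycle twists only the product, so the obvious section is linear, though
    not multiplicative.\<close>
  show "\<exists>s\<in>module_hom \<Z> (int_poly_algebra n) ext_algebra.
      \<forall>a\<in>carrier (int_poly_algebra n). ext_proj (s a) = a"
    by (rule bexI[of _ "\<lambda>f. h (f, 0)"]) (auto simp: module_hom_def int_poly_algebra_simps)
  \<comment> \<open>Both polynomial parts are 0, and \<open>coeff0\<close> and \<open>coeff1\<close>
    vanish at 0, so all summands of the product vanish.\<close>
  show "u \<otimes>\<^bsub>ext_algebra\<^esub> v = \<zero>\<^bsub>ext_algebra\<^esub>"
    if "u \<in> a_kernel ext_algebra (int_poly_algebra n) ext_proj"
      "v \<in> a_kernel ext_algebra (int_poly_algebra n) ext_proj" for u v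
    using that by (auto simp flip: ext_kernel_eq elim!: ext_kernel_cases)
\<comment> \<open>If one factor lies in the kernel, the cocycle term is 0 and the product reduces to
  the action through \<open>coeff0\<close>.\<close>
qed (auto simp flip: ext_kernel_eq elim!: ext_kernel_cases ext_algebra_cases)

lemma ext_not_lifts: "\<not> extension_lifts \<Z> (int_poly_algebra n) ext_algebra ext_proj"
proof
  assume "extension_lifts \<Z> (int_poly_algebra n) ext_algebra ext_proj"
  then obtain s where s: "s \<in> ring_hom (int_poly_algebra n) ext_algebra"
    and sec: "\<And>f. f \<in> carrier (int_poly_algebra n) \<Longrightarrow> ext_proj (s f) = f"
    by (auto simp: extension_lifts_def algebra_hom_def)
  have lift: "\<exists>x. s f = h (f, x)" if "f \<in> carrier (int_poly_algebra n)" for f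
    using sec[OF that] ring_hom_closed[OF s that] by (auto elim!: ext_algebra_cases)
  \<comment> \<open>Here \<open>n > 1\<close> enters: two distinct variables are required.\<close>
  have closed: "var 1 \<in> carrier (int_poly_algebra n)" "var 2 \<in> carrier (int_poly_algebra n)"
    using n_gt_1 by (simp_all add: var_closed)
  obtain x y where "s (var 1) = h (var 1, x)" "s (var 2) = h (var 2, y)"
    using lift closed by meson
  moreover have "s (var 1) \<otimes>\<^bsub>ext_algebra\<^esub> s (var 2) = s (var 2) \<otimes>\<^bsub>ext_algebra\<^esub> s (var 1)"
    using closed by (metis ring_hom_mult[OF s] int_poly_algebra_simps(4) mult.commute)
  \<comment> \<open>Since \<open>coeff0 (var i) = 0\<close>, the unknown \<open>x\<close> and
    \<open>y\<close> drop out of both products. The kernel components are 1 for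
    \<open>x_1 x_2\<close> and 0 for \<open>x_2 x_1\<close>.\<close>
  ultimately show False
    by (simp add: coeff1_var)
qed

end

theorem corollary2p3:
  fixes n :: nat
  assumes "n > 1" and "infinite (UNIV :: 'u set)"
  shows "\<not> quasi_free TYPE('u) \<Z> (int_poly_algebra n)"
proof -
  \<comment> \<open>An infinite type contains a copy of the natural numbers, hence of every
    countable type; this places both the bimodule and the algebra inside \<open>'u\<close>.\<close>
  obtain e :: "nat \<Rightarrow> 'u" where "inj e"
    using infinite_countable_subset[OF assms(2)] by blast
  then have "inj (e \<circ> (to_nat :: int_poly \<times> int \<Rightarrow> nat))"
    by (simp add: inj_compose)
  then interpret noncommutative_extension "e \<circ> to_nat" n
    using assms(1) by unfold_locales
  show ?thesis
    using ext_hochschild ext_not_lifts by (auto simp: quasi_free_def)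
qed

end
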